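(* Let $n\ge 1$ and assume that the partition graph $G_n$ is connected. Let $S,T\subseteq V(G_n)$ be nonempty. Then the following are equivalent: (i) $S$ and $T$ are directionally equivalent, i.e. $\sigma_S(\lambda,\mu)=\sigma_T(\lambda,\mu)$ for every oriented edge $(\lambda,\mu)$ of $G_n$; (ii) the function $d_S-d_T$ is constant on $V(G_n)$.
   Context: Partition graph: for $n\ge 1$, the vertices of the simple graph $G_n$ are the partitions $\lambda=(\lambda_1\ge\dots\ge\lambda_k>0)$ of $n$. An elementary unit transfer on $\lambda=(\lambda_1,\dots,\lambda_k)$: choose distinct indices $i,j\in\{1,\dots,k\}$, replace $\lambda_i$ by $\lambda_i+1$ and $\lambda_j$ by $\lambda_j-1$, delete the latter if it becomes $0$, and reorder the parts into nonincreasing form; if the resulting partition $\mu$ satisfies $\mu\neq\lambda$, then $\mu$ is obtained from $\lambda$ by an elementary unit transfer. Two partitions $\lambda,\mu$ of $n$ are adjacent in $G_n$ if one of them is obtained from the other by a single elementary unit transfer. For nonempty $S\subseteq V(G_n)$, $d_S(\lambda)=\min_{\sigma\in S}d_{G_n}(\lambda,\sigma)$, where $d_{G_n}$ is the graph distance. An oriented edge is an ordered pair $(\lambda,\mu)$ of adjacent vertices, and $\sigma_S(\lambda,\mu)=d_S(\mu)-d_S(\lambda)\in\{-1,0,+1\}$. *)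

theory Defs
  imports "Graph_Theory.Graph_Theory"
begin

definition partitions :: "nat \<Rightarrow> nat list set" where
  "partitions n = {xs. sorted_wrt (\<ge>) xs \<and> (\<forall>x\<in>set xs. 0 < x) \<and> sum_list xs = n}"

text \<open>Since the parts of a partition are positive, the only entry that can vanish under a
  transfer is the decreased one, so removing all zeros deletes exactly that part.\<close>
definition unit_transfer :: "nat list \<Rightarrow> nat list \<Rightarrow> bool" where
  "unit_transfer xs ys \<longleftrightarrow>
     (\<exists>i<length xs. \<exists>j<length xs. i \<noteq> j \<and>
        ys = rev (sort (removeAll 0 (xs[i := xs ! i + 1, j := xs ! j - 1])))) \<and>
     ys \<noteq> xs"

text \<open>The simple graph is encoded as a symmetric digraph: each undirected edge gives two arcs,
  which are its two orientations.\<close>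
definition partition_graph :: "nat \<Rightarrow> (nat list, nat list \<times> nat list) pre_digraph" where
  "partition_graph n =
     \<lparr>verts = partitions n,
      arcs = {(xs, ys). xs \<in> partitions n \<and> ys \<in> partitions n \<and>
                (unit_transfer xs ys \<or> unit_transfer ys xs)},
      tail = fst, head = snd\<rparr>"

text \<open>Only meaningful when \<open>v\<close> is reachable from \<open>u\<close>, as in a connected graph.\<close>
definition graph_dist :: "('a, 'b) pre_digraph \<Rightarrow> 'a \<Rightarrow> 'a \<Rightarrow> nat" where
  "graph_dist G u v = (LEAST k. \<exists>p. pre_digraph.awalk G u p v \<and> length p = k)"

definition set_dist :: "('a, 'b) pre_digraph \<Rightarrow> 'a set \<Rightarrow> 'a \<Rightarrow> nat" where
  "set_dist G S u = Min (graph_dist G u ` S)"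

definition edge_sign :: "('a, 'b) pre_digraph \<Rightarrow> 'a set \<Rightarrow> 'a \<Rightarrow> 'a \<Rightarrow> int" where
  "edge_sign G S u v = int (set_dist G S v) - int (set_dist G S u)"

definition directionally_equivalent :: "('a, 'b) pre_digraph \<Rightarrow> 'a set \<Rightarrow> 'a set \<Rightarrow> bool" where
  "directionally_equivalent G S T \<longleftrightarrow>
     (\<forall>(u, v) \<in> arcs_ends G. edge_sign G S u v = edge_sign G T u v)"

lemma finite_partitions: "finite (partitions n)"
proof (rule finite_subset)
  have len: "length xs \<le> sum_list xs" if "\<forall>x\<in>set xs. 0 < x" for xs :: "nat list"
    using that by (induction xs) (auto simp: Suc_le_eq intro: add_mono)
  show "partitions n \<subseteq> {xs. set xs \<subseteq> {..n} \<and> length xs \<le> n}"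
    using len by (auto simp: partitions_def dest: member_le_sum_list)
  show "finite {xs. set xs \<subseteq> {..n} \<and> length xs \<le> n}"
    by (rule finite_lists_length_le) simp
qed

lemma graph_partition_graph: "graph (partition_graph n)"
proof -
  have "arcs (partition_graph n) \<subseteq> partitions n \<times> partitions n"
    by (auto simp: partition_graph_def)
  then have "finite (arcs (partition_graph n))"
    by (rule finite_subset) (simp add: finite_partitions)
  then show ?thesis
    by unfold_locales
      (auto simp: partition_graph_def finite_partitions arc_to_ends_def symmetric_conv unit_transfer_def)
qed

text \<open>\<^const>\<open>graph_dist\<close> is the shortest-path distance of the graph library for unit weights.\<close>
lemma (in wf_digraph) graph_dist_eq_shortest_path:
  assumes "u \<rightarrow>\<^sup>* v"
  shows "\<mu> (\<lambda>_. 1) u v = ereal (real (graph_dist G u v))"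
proof -
  have cost: "awalk_cost (\<lambda>_. 1) p = real (length p)" for p
    by (induction p) auto
  have "\<exists>k p. awalk u p v \<and> length p = k"
    using assms by (auto simp: reachable_awalk)
  then have "\<exists>p. awalk u p v \<and> length p = graph_dist G u v"
    unfolding graph_dist_def by (rule LeastI_ex)
  then obtain p where p: "awalk u p v" "length p = graph_dist G u v"
    by blast
  have le: "graph_dist G u v \<le> length q" if "awalk u q v" for q
    unfolding graph_dist_def using that by (auto intro: Least_le)
  show ?thesis
    unfolding \<mu>_def
  proof (rule antisym)
    show "(INF q\<in>{q. awalk u q v}. ereal (awalk_cost (\<lambda>_. 1) q)) \<le> ereal (real (graph_dist G u v))"
      using p by (intro INF_lower2[of p]) (auto simp: cost)
    show "ereal (real (graph_dist G u v)) \<le> (INF q\<in>{q. awalk u q v}. ereal (awalk_cost (\<lambda>_. 1) q))"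
      using le by (intro INF_greatest) (auto simp: cost)
  qed
qed

end

theory Submission
  imports Defs
begin

text \<open>
  Equality of the two signs on an arc \<open>(u, v)\<close> rearranges to
  \<open>d\<^sub>S v - d\<^sub>T v = d\<^sub>S u - d\<^sub>T u\<close>, so directional equivalence says exactly that the difference
  \<open>d\<^sub>S - d\<^sub>T\<close> has the same value at both ends of every edge. On a connected graph such a
  function is constant, since its value propagates along a path between any two vertices
  (\<open>constant_on_connected\<close>). This propagation works on any connected digraph, so the equivalence is
  obtained at that generality (\<open>directionally_equivalent_iff_constant_difference\<close>) and then
  specialised to \<open>G\<^sub>n\<close>.
\<close>

lemma (in wf_digraph) constant_on_connected:
  assumes "Digraph_Component.connected G"
    and edge: "\<And>u v. (u, v) \<in> arcs_ends G \<Longrightarrow> f u = f v"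
    and "u \<in> verts G" "v \<in> verts G"
  shows "f u = f v"
proof -
  \<comment> \<open>Connectedness is strong connectedness of the symmetric closure, so the path from \<open>u\<close> to
    \<open>v\<close> may traverse arcs backwards; invariance along arcs is insensitive to direction.\<close>
  have "u \<rightarrow>\<^sup>*\<^bsub>with_proj (mk_symmetric G)\<^esub> v"
    using assms(1,3,4) by (auto simp: connected_def)
  then show ?thesis
    unfolding reachable_def
  proof (induction rule: rtrancl_on_induct)
    case (step x y)
    then have "(x, y) \<in> arcs_ends G \<or> (y, x) \<in> arcs_ends G"
      by (auto simp: parcs_mk_symmetric intro: in_arcs_imp_in_arcs_ends)
    with step.IH show ?case
      by (auto dest: edge)
  qed simp
qed

lemma (in wf_digraph) directionally_equivalent_iff_constant_difference:
  assumes "Digraph_Component.connected G"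
  shows "directionally_equivalent G S T \<longleftrightarrow>
    (\<exists>c::int. \<forall>u \<in> verts G. int (set_dist G S u) - int (set_dist G T u) = c)"
proof -
  define f where "f u = int (set_dist G S u) - int (set_dist G T u)" for u
  have dir: "directionally_equivalent G S T \<longleftrightarrow> (\<forall>(u, v) \<in> arcs_ends G. f u = f v)"
    by (auto simp: directionally_equivalent_def edge_sign_def f_def algebra_simps)
  have "(\<forall>(u, v) \<in> arcs_ends G. f u = f v) \<longleftrightarrow> (\<exists>c. \<forall>u \<in> verts G. f u = c)"
  proof
    assume "\<forall>(u, v) \<in> arcs_ends G. f u = f v"
    then have "f u = f v" if "u \<in> verts G" "v \<in> verts G" for u v
      using constant_on_connected[OF assms, of f] that by blast
    then show "\<exists>c. \<forall>u \<in> verts G. f u = c"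
      by blast
  next
    assume "\<exists>c. \<forall>u \<in> verts G. f u = c"
    then show "\<forall>(u, v) \<in> arcs_ends G. f u = f v"
      by (auto dest: adj_in_verts)
  qed
  with dir show ?thesis
    by (simp add: f_def)
qed

theorem theorem5p5:
  fixes n :: nat and S T :: "nat list set"
  assumes "n \<ge> 1"
    and "Digraph_Component.connected (partition_graph n)"
    and "S \<subseteq> verts (partition_graph n)" and "S \<noteq> {}"
    and "T \<subseteq> verts (partition_graph n)" and "T \<noteq> {}"
  shows "directionally_equivalent (partition_graph n) S T \<longleftrightarrow>
    (\<exists>c::int. \<forall>u \<in> verts (partition_graph n).
       int (set_dist (partition_graph n) S u) - int (set_dist (partition_graph n) T u) = c)"
proof -
  interpret graph "partition_graph n"
    by (rule graph_partition_graph)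
  show ?thesis
    using assms(2) by (rule directionally_equivalent_iff_constant_difference)
qed

end
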